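(* Let $\mathcal{A}$ be a unital Banach algebra, let $n\geq 1$ be an integer, and let $a_0,a_1,\dots,a_{n-1}\in\mathcal{A}$. Let $p(z)=a_0+a_1z+\cdots+a_{n-1}z^{n-1}+z^n\in\mathcal{A}[z]$. Let $u\in\mathcal{A}$ be such that $p(u)=0$ and $\|u^n\|=\|u\|^n$. Then $$\|u\|<1+\max_{0\leq j\leq n-1}\|a_j\|.$$
   Context: Here $\mathcal{A}$ is a (possibly noncommutative) Banach algebra with unit $1\neq 0$, and $\mathcal{A}[z]$ is the set of polynomials over $\mathcal{A}$. Coefficients are written on the left of the powers of $z$, and $p(u)$ means $p(u)=a_0+a_1u+\cdots+a_{n-1}u^{n-1}+u^n$. *)

theory Defs
  imports "HOL-Analysis.Analysis" "HOL-Computational_Algebra.Polynomial"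
begin

text \<open>
  The library's \<open>poly\<close> evaluates polynomials over commutative semirings only. Over a possibly
  noncommutative ring, coefficients are kept to the left of the powers of the argument.
\<close>

definition left_eval :: "'a::semiring_1 poly \<Rightarrow> 'a \<Rightarrow> 'a" where
  "left_eval p u = (\<Sum>i\<le>degree p. coeff p i * u ^ i)"

end

theory Submission imports Defs begin

text \<open>
  Put \<open>r = norm u\<close> and let \<open>M\<close> be the largest of the coefficient norms. The equation \<open>p(u) = 0\<close>
  expresses \<open>u ^ n\<close> through lower powers of \<open>u\<close>, so \<open>norm (u ^ n) = r ^ n\<close> yields Cauchy's
  inequality \<open>r ^ n \<le> M * (\<Sum>j<n. r ^ j)\<close>. If \<open>r\<close> were at least \<open>1 + M\<close>, then \<open>M \<le> r - 1\<close>, and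
  the geometric sum would give \<open>r ^ n \<le> (r - 1) * (\<Sum>j<n. r ^ j) = r ^ n - 1\<close>, which is absurd.
\<close>

text \<open>
  As \<open>norm 1\<close> may exceed 1, the bound \<open>norm (u ^ j) \<le> norm u ^ j\<close> can fail for \<open>j = 0\<close>. With a
  factor in front it holds for every \<open>j\<close>, because \<open>x * u ^ 0\<close> is \<open>x\<close> itself.
\<close>

lemma norm_mult_power_le:
  fixes x u :: "'a::{real_normed_algebra, ring_1}"
  shows "norm (x * u ^ j) \<le> norm x * norm u ^ j"
proof (induction j)
  case 0
  show ?case by simp
next
  case (Suc j)
  have "norm (x * u ^ Suc j) = norm ((x * u ^ j) * u)"
    by (simp only: power_Suc2 mult.assoc)
  also have "\<dots> \<le> norm (x * u ^ j) * norm u"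
    by (rule norm_mult_ineq)
  also have "\<dots> \<le> norm x * norm u ^ j * norm u"
    using Suc.IH by (rule mult_right_mono) simp
  finally show ?case by (simp add: mult_ac)
qed

lemma left_eval_monic:
  fixes a :: "nat \<Rightarrow> 'a::ring_1"
  shows "left_eval ((\<Sum>j<n. monom (a j) j) + monom 1 n) u = (\<Sum>j<n. a j * u ^ j) + u ^ n"
    (is "left_eval ?p u = _")
proof -
  have coeff: "coeff ?p i = (if i < n then a i else if i = n then 1 else 0)" for i
    by (auto simp: coeff_sum)
  have "degree ?p = n"
  proof (rule antisym)
    show "degree ?p \<le> n"
      by (rule degree_le) (simp add: coeff_sum)
    show "n \<le> degree ?p"
      by (rule le_degree) (simp add: coeff_sum)
  qed
  then have "left_eval ?p u = (\<Sum>i\<le>n. coeff ?p i * u ^ i)"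
    by (simp only: left_eval_def)
  also have "\<dots> = (\<Sum>j<n. a j * u ^ j) + u ^ n"
    by (simp only: coeff lessThan_Suc_atMost[symmetric] sum.lessThan_Suc) simp
  finally show ?thesis .
qed

text \<open>
  Multiplying by \<open>r - 1\<close> rather than dividing by it keeps the case \<open>r = 1\<close>, \<open>M = 0\<close> within the
  same argument.
\<close>

lemma less_one_plus_if_power_le_geometric_sum:
  fixes r M :: real
  assumes "0 \<le> r" and "r ^ n \<le> M * (\<Sum>j<n. r ^ j)"
  shows "r < 1 + M"
proof (rule ccontr)
  assume "\<not> r < 1 + M"
  then have "M * (\<Sum>j<n. r ^ j) \<le> (r - 1) * (\<Sum>j<n. r ^ j)"
    using assms(1) by (intro mult_right_mono sum_nonneg) auto
  also have "\<dots> = r ^ n - 1"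
    by (rule power_diff_1_eq[symmetric])
  finally show False
    using assms(2) by simp
qed

theorem theorem2p1:
  fixes a :: "nat \<Rightarrow> 'a::{real_normed_algebra, ring_1, banach}"
    and u :: 'a
    and n :: nat
    and p :: "'a poly"
  assumes "n \<ge> 1"
    and "p = (\<Sum>j<n. monom (a j) j) + monom 1 n"
    and "left_eval p u = 0"
    and "norm (u ^ n) = norm u ^ n"
  shows "norm u < 1 + Max ((\<lambda>j. norm (a j)) ` {0..n - 1})"
proof -
  define M where "M = Max ((\<lambda>j. norm (a j)) ` {0..n - 1})"
  have coeff_le: "norm (a j) \<le> M" if "j < n" for j
    unfolding M_def using that by (intro Max_ge) auto
  have "(\<Sum>j<n. a j * u ^ j) + u ^ n = 0"
    using assms(2,3) by (simp add: left_eval_monic)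
  then have "u ^ n = - (\<Sum>j<n. a j * u ^ j)"
    by (simp add: eq_neg_iff_add_eq_0 add.commute)
  then have "norm u ^ n = norm (\<Sum>j<n. a j * u ^ j)"
    using assms(4) by simp
  also have "\<dots> \<le> (\<Sum>j<n. M * norm u ^ j)"
  proof (rule sum_norm_le)
    fix j assume "j \<in> {..<n}"
    then have "norm (a j) * norm u ^ j \<le> M * norm u ^ j"
      by (intro mult_right_mono coeff_le) auto
    with norm_mult_power_le show "norm (a j * u ^ j) \<le> M * norm u ^ j"
      by (rule order_trans)
  qed
  also have "\<dots> = M * (\<Sum>j<n. norm u ^ j)"
    by (rule sum_distrib_left[symmetric])
  finally show ?thesis
    unfolding M_def[symmetric] by (intro less_one_plus_if_power_le_geometric_sum) simp
qed

end
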